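(* For every positive integer $h$, the distance spectral radius of the multiplicative circulant graph $MC(2^h)$ is $$\rho(MC(2^h))=\frac{2^h(3h+1)-(-1)^h}{9}.$$
   Context: For integers $m>1$, $h>0$, $MC(m^h)$ is the graph with vertex set $\mathbb{Z}_{m^h}$ in which distinct vertices $x,y$ are adjacent iff $x-y\equiv \pm m^i \pmod{m^h}$ for some $i\in\{0,\ldots,h-1\}$. The distance spectral radius of a graph is the largest eigenvalue of its distance matrix $[d(v_i,v_j)]$ of shortest-path distances. *)

theory Defs
  imports
    "HOL-Number_Theory.Cong"
    "Jordan_Normal_Form.Spectral_Radius"
    "Graph_Theory.Pair_Digraph"
    "Graph_Theory.Shortest_Path"
begin

text \<open>
  The argument pair \<open>m\<close>, \<open>h\<close> stands for \<open>MC(m^h)\<close>. The elements of \<open>\<int>/m^h\<close> are represented by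
  their least residues \<open>0, \<dots>, m^h - 1\<close>; differences are taken in \<open>int\<close> to avoid truncation.
  The undirected graph is encoded as a loop-free symmetric digraph.
\<close>

definition MC :: "nat \<Rightarrow> nat \<Rightarrow> nat pair_pre_digraph" where
  "MC m h = \<lparr> pverts = {0..<m ^ h},
     parcs = {(x, y). x \<in> {0..<m ^ h} \<and> y \<in> {0..<m ^ h} \<and> x \<noteq> y \<and>
       (\<exists>i<h. [int x - int y = int m ^ i] (mod int m ^ h) \<or>
              [int x - int y = - (int m ^ i)] (mod int m ^ h))} \<rparr>"

lemma pair_graph_MC: "pair_graph (MC m h)"
proof
  show "finite (parcs (MC m h))"
    by (rule finite_subset[of _ "{0..<m ^ h} \<times> {0..<m ^ h}"]) (auto simp: MC_def)
  have swap: "[a - b = c] (mod n) \<longleftrightarrow> [b - a = - c] (mod n)" for a b c n :: int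
    using cong_minus_minus_iff[of "a - b" c n] by simp
  have "(y, x) \<in> parcs (MC m h)" if "(x, y) \<in> parcs (MC m h)" for x y
  proof -
    from that obtain i where "i < h" and
      "[int x - int y = int m ^ i] (mod int m ^ h) \<or>
       [int x - int y = - (int m ^ i)] (mod int m ^ h)"
      by (auto simp: MC_def)
    then have "[int y - int x = int m ^ i] (mod int m ^ h) \<or>
       [int y - int x = - (int m ^ i)] (mod int m ^ h)"
      using swap[of "int x" "int y"] by fastforce
    with \<open>i < h\<close> that show ?thesis
      by (auto simp: MC_def)
  qed
  then show "symmetric (with_proj (MC m h))"
    by (auto simp: symmetric_def arcs_ends_def arc_to_ends_def with_proj_def sym_def)
qed (auto simp: MC_def)

text \<open>
  Shortest-path distance is the library's least walk cost with unit arc weights. In a connected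
  graph this is finite, so \<open>real_of_ereal\<close> loses nothing.
\<close>

definition graph_dist :: "'a pair_pre_digraph \<Rightarrow> 'a \<Rightarrow> 'a \<Rightarrow> real" where
  "graph_dist G u v = real_of_ereal (wf_digraph.\<mu> (with_proj G) (\<lambda>_. 1) u v)"

definition distance_matrix :: "'a::linorder pair_pre_digraph \<Rightarrow> real mat" where
  "distance_matrix G =
     (let vs = sorted_list_of_set (pverts G)
      in mat (length vs) (length vs) (\<lambda>(i, j). graph_dist G (vs ! i) (vs ! j)))"

text \<open>
  The distance matrix of an undirected graph is real symmetric, so all its eigenvalues are real
  and it suffices to consider the spectrum over the reals.
\<close>

definition distance_spectral_radius :: "'a::linorder pair_pre_digraph \<Rightarrow> real" where
  "distance_spectral_radius G = Max (spectrum (distance_matrix G))"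

end

theory Submission
  imports Defs
begin

text \<open>
  Distances in \<open>MC(2^h)\<close> depend only on the difference of the endpoints, so all rows of the
  distance matrix have the same sum \<open>S\<^sub>h\<close>, which is therefore its largest eigenvalue.
  The distance \<open>w\<^sub>h(x)\<close> of \<open>x\<close> from \<open>0\<close> satisfies \<open>w\<^sub>h\<^sub>+\<^sub>1(2x) = w\<^sub>h(x)\<close> and
  \<open>w\<^sub>h\<^sub>+\<^sub>1(2x+1) = 1 + min (w\<^sub>h(x)) (w\<^sub>h(x+1))\<close>. With \<open>M\<^sub>h\<close> the sum of \<open>min (w\<^sub>h(x)) (w\<^sub>h(x+1))\<close>
  over one period, this gives \<open>S\<^sub>h\<^sub>+\<^sub>1 = S\<^sub>h + 2^h + M\<^sub>h\<close>. Neighbouring values of \<open>w\<^sub>h\<close> differ by at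
  most one, whence \<open>M\<^sub>h\<^sub>+\<^sub>1 = 2 S\<^sub>h\<close>; the resulting linear recurrence for \<open>S\<^sub>h\<close> is solved by the
  stated formula.
\<close>

section \<open>The distance from zero\<close>

text \<open>An odd \<open>x\<close> is first moved to \<open>x - 1\<close> or \<open>x + 1\<close>,
  whose halves are the two arguments of the minimum; then everything is halved. The domain is all of
  \<open>int\<close>, so shifts need no reduction modulo \<open>2 ^ h\<close>.\<close>

fun wt :: "nat \<Rightarrow> int \<Rightarrow> nat" where
  "wt 0 x = 0"
| "wt (Suc h) x =
     (if even x then wt h (x div 2) else Suc (min (wt h (x div 2)) (wt h (x div 2 + 1))))"

lemma wt_even: "wt (Suc h) (2 * y) = wt h y"
  by simp

lemma wt_odd: "wt (Suc h) (2 * y + 1) = Suc (min (wt h y) (wt h (y + 1)))"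
  by simp

declare wt.simps(2) [simp del]

lemma wt_zero [simp]: "wt h 0 = 0"
  by (induction h) (simp_all add: wt.simps(2))

lemma wt_add_period: "wt h (x + 2 ^ h * k) = wt h x"
proof (induction h arbitrary: x)
  case 0
  then show ?case by simp
next
  case (Suc h)
  show ?case
  proof (cases "even x")
    case True
    then obtain y where x: "x = 2 * y" by blast
    have "x + 2 ^ Suc h * k = 2 * (y + 2 ^ h * k)" by (simp add: x)
    then show ?thesis using Suc[of y] by (simp only: wt_even x)
  next
    case False
    then obtain y where x: "x = 2 * y + 1" by (blast elim: oddE)
    have "x + 2 ^ Suc h * k = 2 * (y + 2 ^ h * k) + 1" by (simp add: x)
    moreover have "y + 2 ^ h * k + 1 = (y + 1) + 2 ^ h * k" by simp
    ultimately show ?thesis using Suc[of y] Suc[of "y + 1"] by (simp only: wt_odd x)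
  qed
qed

lemma wt_cong:
  assumes "[x = y] (mod 2 ^ h)"
  shows "wt h x = wt h y"
proof -
  from assms obtain k where "y = x + 2 ^ h * k"
    by (auto simp: cong_iff_lin)
  then show ?thesis by (simp add: wt_add_period)
qed

lemma wt_eq_0_imp_dvd: "wt h x = 0 \<Longrightarrow> 2 ^ h dvd x"
proof (induction h arbitrary: x)
  case 0
  then show ?case by simp
next
  case (Suc h)
  then have "even x" by (auto simp: wt.simps(2) split: if_splits)
  then obtain y where x: "x = 2 * y" by blast
  with Suc show ?case by (simp add: wt_even)
qed

text \<open>A step \<open>2 ^ Suc j\<close> acts on the halves as a step \<open>2 ^ j\<close>, and a
  minimum moves by at most one if both arguments do. A step \<open>1\<close> changes parity, and the
  case \<open>i = 0\<close> of the hypothesis compares the neighbouring halves. Having both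
  directions covers negative steps as well.\<close>

lemma wt_add_power2_bounds:
  "wt h (x + 2 ^ i) \<le> Suc (wt h x) \<and> wt h x \<le> Suc (wt h (x + 2 ^ i))"
proof (induction h arbitrary: x i)
  case 0
  then show ?case by simp
next
  case (Suc h)
  have step: "wt h (y + 1) \<le> Suc (wt h y) \<and> wt h y \<le> Suc (wt h (y + 1))" for y
    using Suc[of y 0] by simp
  show ?case
  proof (cases i)
    case 0
    show ?thesis
    proof (cases "even x")
      case True
      then obtain y where x: "x = 2 * y" by blast
      show ?thesis
        using step[of y] wt_odd[of h y] wt_even[of h y] by (simp add: x 0 min_def)
    next
      case False
      then obtain y where x: "x = 2 * y + 1" by (blast elim: oddE)
      have "x + 2 ^ i = 2 * (y + 1)" by (simp add: x 0)
      then show ?thesis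
        using step[of y] wt_odd[of h y] wt_even[of h "y + 1"]
        by (simp add: x min_def add.commute)
    qed
  next
    case i: (Suc j)
    show ?thesis
    proof (cases "even x")
      case True
      then obtain y where x: "x = 2 * y" by blast
      have "x + 2 ^ i = 2 * (y + 2 ^ j)" by (simp add: x i)
      then show ?thesis
        using Suc[of y j] wt_even[of h y] wt_even[of h "y + 2 ^ j"] by (simp add: x)
    next
      case False
      then obtain y where x: "x = 2 * y + 1" by (blast elim: oddE)
      have eq: "x + 2 ^ i = 2 * (y + 2 ^ j) + 1" by (simp add: x i)
      have "y + 2 ^ j + 1 = y + 1 + 2 ^ j" by simp
      then have odd': "wt (Suc h) (x + 2 ^ i) =
          Suc (min (wt h (y + 2 ^ j)) (wt h (y + 1 + 2 ^ j)))"
        unfolding eq wt_odd by (simp only:)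
      show ?thesis
        using Suc[of y j] Suc[of "y + 1" j] unfolding odd' unfolding x wt_odd by linarith
    qed
  qed
qed

lemma wt_Suc_bounds: "wt h (x + 1) \<le> Suc (wt h x)" "wt h x \<le> Suc (wt h (x + 1))"
  using wt_add_power2_bounds[of h x 0] by simp_all

lemma wt_le_of_step:
  assumes "d = 2 ^ i \<or> d = - (2 ^ i)"
  shows "wt h (x + d) \<le> Suc (wt h x)"
  using assms wt_add_power2_bounds[of h x i] wt_add_power2_bounds[of h "x - 2 ^ i" i] by auto

text \<open>Supplies the first arc of a shortest walk. For even \<open>x\<close>, double the step
  found for the half; for odd \<open>x\<close>, move to the neighbour whose half attains the
  minimum.\<close>

lemma wt_decreasing_step:
  assumes "wt h x > 0"
  shows "\<exists>i d. i < h \<and> (d = 2 ^ i \<or> d = - (2 ^ i)) \<and> Suc (wt h (x + d)) = wt h x"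
  using assms
proof (induction h arbitrary: x)
  case 0
  then show ?case by simp
next
  case (Suc h)
  show ?case
  proof (cases "even x")
    case True
    then obtain y where x: "x = 2 * y" by blast
    then have "wt h y > 0" using Suc.prems by (simp add: wt_even)
    then obtain i d where id: "i < h" "d = 2 ^ i \<or> d = - (2 ^ i)" "Suc (wt h (y + d)) = wt h y"
      using Suc.IH by blast
    have "Suc (wt (Suc h) (x + 2 * d)) = wt (Suc h) x"
      using id(3) wt_even[of h "y + d"] wt_even[of h y] by (simp add: x)
    then show ?thesis
      using id(1,2) by (intro exI[of _ "Suc i"] exI[of _ "2 * d"]) auto
  next
    case False
    then obtain y where x: "x = 2 * y + 1" by (blast elim: oddE)
    have "Suc (wt (Suc h) (x - 1)) = wt (Suc h) x \<or> Suc (wt (Suc h) (x + 1)) = wt (Suc h) x"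
      using wt_even[of h y] wt_even[of h "y + 1"] wt_odd[of h y]
      by (auto simp: x min_def add.commute)
    then show ?thesis
      by (auto intro!: exI[of _ "0::nat"])
  qed
qed

section \<open>Summing the distances\<close>

text \<open>The map sending \<open>j\<close> to \<open>a - j\<close> modulo \<open>n\<close> is an
  involution of the residues.\<close>

lemma sum_periodic_reflect:
  fixes f :: "int \<Rightarrow> 'a::comm_monoid_add" and n :: nat
  assumes "n > 0" and periodic: "\<And>x. f (x mod int n) = f x"
  shows "(\<Sum>j<n. f (a - int j)) = (\<Sum>j<n. f (int j))"
proof -
  let ?r = "\<lambda>j. nat ((a - int j) mod int n)"
  have int_r: "int (?r j) = (a - int j) mod int n" for j
    using \<open>n > 0\<close> by simp
  have bound: "?r j < n" for j
    using \<open>n > 0\<close> by (simp add: nat_less_iff)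
  have invol: "?r (?r j) = j" if "j < n" for j
    using that by (simp add: int_r mod_diff_right_eq)
  show ?thesis
  proof (rule sum.reindex_bij_witness[of _ ?r ?r])
    fix j
    show "f (int (?r j)) = f (a - int j)"
      by (simp only: int_r periodic)
  qed (use invol bound in auto)
qed

text \<open>A shift is a composition of two reflections.\<close>

lemma sum_periodic_shift:
  fixes f :: "int \<Rightarrow> 'a::comm_monoid_add" and n :: nat
  assumes "n > 0" and periodic: "\<And>x. f (x mod int n) = f x"
  shows "(\<Sum>j<n. f (int j + a)) = (\<Sum>j<n. f (int j))"
proof -
  have "f (a - x mod int n) = f (a - x)" for x
    using periodic[of "a - x mod int n"] periodic[of "a - x"] by (simp add: mod_diff_right_eq)
  from sum_periodic_reflect[of n "\<lambda>x. f (a - x)" 0, OF \<open>n > 0\<close> this]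
  have "(\<Sum>j<n. f (int j + a)) = (\<Sum>j<n. f (a - int j))"
    by (simp add: add.commute)
  also have "\<dots> = (\<Sum>j<n. f (int j))"
    by (rule sum_periodic_reflect) (use assms in auto)
  finally show ?thesis .
qed

lemma sum_lessThan_double:
  fixes f :: "nat \<Rightarrow> 'a::comm_monoid_add"
  shows "(\<Sum>x<2 * n. f x) = (\<Sum>x<n. f (2 * x) + f (2 * x + 1))"
  by (induction n) (simp_all add: add.assoc)

lemma wt_mod: "wt h (x mod int (2 ^ h)) = wt h x"
  by (rule wt_cong) (simp add: cong_def)

definition wt_sum :: "nat \<Rightarrow> nat" where
  "wt_sum h = (\<Sum>x<2 ^ h. wt h (int x))"

definition wt_min_sum :: "nat \<Rightarrow> nat" where
  "wt_min_sum h = (\<Sum>x<2 ^ h. min (wt h (int x)) (wt h (int x + 1)))"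

lemma wt_sum_Suc: "wt_sum (Suc h) = wt_sum h + 2 ^ h + wt_min_sum h"
proof -
  have "wt_sum (Suc h) =
      (\<Sum>x<2 ^ h. wt (Suc h) (int (2 * x)) + wt (Suc h) (int (2 * x + 1)))"
    unfolding wt_sum_def power_Suc by (rule sum_lessThan_double)
  also have "\<dots> = (\<Sum>x<2 ^ h. wt h (int x) + (1 + min (wt h (int x)) (wt h (int x + 1))))"
  proof (rule sum.cong[OF refl])
    fix x :: nat
    show "wt (Suc h) (int (2 * x)) + wt (Suc h) (int (2 * x + 1)) =
        wt h (int x) + (1 + min (wt h (int x)) (wt h (int x + 1)))"
      using wt_even[of h "int x"] wt_odd[of h "int x"] by (simp add: add.commute)
  qed
  also have "\<dots> = wt_sum h + 2 ^ h + wt_min_sum h"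
    unfolding sum.distrib by (simp add: wt_sum_def wt_min_sum_def)
  finally show ?thesis .
qed

text \<open>Let \<open>a\<close>, \<open>b\<close> be the values of \<open>wt h\<close> at
  \<open>x\<close> and \<open>x + 1\<close>. As they differ by at most one, the value
  \<open>Suc (min a b)\<close> at the odd point between them is at least both, so the two minima are
  \<open>a\<close> and \<open>b\<close>.\<close>

lemma wt_min_sum_Suc: "wt_min_sum (Suc h) = 2 * wt_sum h"
proof -
  let ?m = "\<lambda>z. min (wt (Suc h) z) (wt (Suc h) (z + 1))"
  have "wt_min_sum (Suc h) = (\<Sum>x<2 ^ h. ?m (int (2 * x)) + ?m (int (2 * x + 1)))"
    unfolding wt_min_sum_def power_Suc by (rule sum_lessThan_double)
  also have "\<dots> = (\<Sum>x<2 ^ h. wt h (int x) + wt h (int x + 1))"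
  proof (rule sum.cong[OF refl])
    fix x :: nat
    have e: "wt (Suc h) (int (2 * x)) = wt h (int x)"
      using wt_even[of h "int x"] by simp
    have o: "wt (Suc h) (int (2 * x) + 1) = Suc (min (wt h (int x)) (wt h (int x + 1)))"
      using wt_odd[of h "int x"] by simp
    have e': "wt (Suc h) (int (2 * x) + 1 + 1) = wt h (int x + 1)"
      using wt_even[of h "int x + 1"] by (simp add: algebra_simps)
    have "int (2 * x + 1) = int (2 * x) + 1" by simp
    then show "?m (int (2 * x)) + ?m (int (2 * x + 1)) = wt h (int x) + wt h (int x + 1)"
      using wt_Suc_bounds[of h "int x"] e o e' by (simp only:)
  qed
  also have "\<dots> = 2 * wt_sum h"
    using sum_periodic_shift[of "2 ^ h" "wt h" 1, OF _ wt_mod]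
    by (simp add: sum.distrib wt_sum_def)
  finally show ?thesis .
qed

text \<open>The recurrence has characteristic roots 2 and -1. Its forcing term is a multiple of
  \<open>2 ^ h\<close>, in resonance with the root 2, which produces the summand with
  \<open>h * 2 ^ h\<close>.\<close>

lemma wt_sum_closed_form: "real (wt_sum h) = (2 ^ h * (3 * real h + 1) - (-1) ^ h) / 9"
proof (induction h rule: induct_nat_012)
  case 0
  then show ?case by (simp add: wt_sum_def)
next
  case 1
  then show ?case by (simp add: wt_sum_Suc[of 0, simplified] wt_sum_def[of 0] wt_min_sum_def[of 0])
next
  case (ge2 h)
  have "real (wt_sum (Suc (Suc h))) = real (wt_sum (Suc h)) + 2 * 2 ^ h + 2 * real (wt_sum h)"
    by (simp add: wt_sum_Suc[of "Suc h"] wt_min_sum_Suc)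
  then show ?case unfolding ge2 by (simp add: field_simps)
qed

section \<open>Distances in the graph\<close>

lemma wf_digraph_MC: "wf_digraph (with_proj (MC m h))"
  using pair_graph_MC[of m h] by (auto simp: wf_digraph_wp_iff pair_graph_def pair_digraph_def pair_fin_digraph_def)

text \<open>Along each arc the difference to \<open>v\<close> changes by a signed power of 2 modulo
  \<open>2 ^ h\<close>, so its \<open>wt\<close> drops by at most one; at \<open>v\<close> it is
  0.\<close>

lemma wt_le_length_awalk:
  assumes "pre_digraph.awalk (with_proj (MC 2 h)) u p v"
  shows "wt h (int u - int v) \<le> length p"
proof -
  interpret wf_digraph "with_proj (MC 2 h)" by (rule wf_digraph_MC)
  show ?thesis using assms
  proof (induction p arbitrary: u)
    case Nil
    then show ?case by (simp add: awalk_Nil_iff)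
  next
    case (Cons e p)
    obtain x y where e: "e = (x, y)" by fastforce
    from Cons.prems have u: "u = x" and arc: "(x, y) \<in> parcs (MC 2 h)" and walk: "awalk y p v"
      by (simp_all add: awalk_Cons_iff e)
    from arc obtain d :: int and k :: nat where
      d: "d = 2 ^ k \<or> d = - (2 ^ k)" and cong: "[int x - int y = d] (mod 2 ^ h)"
      by (auto simp: MC_def)
    have "[(int x - int y) + (int y - int v) = d + (int y - int v)] (mod 2 ^ h)"
      using cong by (intro cong_add) auto
    then have "wt h (int x - int v) = wt h ((int y - int v) + d)"
      by (intro wt_cong) (simp add: algebra_simps)
    also have "\<dots> \<le> Suc (wt h (int y - int v))"
      using d by (rule wt_le_of_step)
    also have "\<dots> \<le> length (e # p)"
      using Cons.IH[OF walk] by simp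
    finally show ?case by (simp add: u)
  qed
qed

text \<open>Steps that decrease \<open>wt\<close> are followed until it reaches 0.\<close>

lemma ex_awalk_length_wt:
  assumes "u < 2 ^ h" "v < 2 ^ h"
  shows "\<exists>p. pre_digraph.awalk (with_proj (MC 2 h)) u p v \<and> length p = wt h (int u - int v)"
proof -
  interpret wf_digraph "with_proj (MC 2 h)" by (rule wf_digraph_MC)
  show ?thesis using assms(1)
  proof (induction "wt h (int u - int v)" arbitrary: u)
    case 0
    \<comment> \<open>Value 0 only gives congruence of \<open>u\<close> and \<open>v\<close>;
      equality follows because both are least residues.\<close>
    then have "[int u = int v] (mod int (2 ^ h))"
      using wt_eq_0_imp_dvd[of h "int u - int v"] by (simp add: cong_iff_dvd_diff)
    then have "[u = v] (mod 2 ^ h)"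
      by (simp only: cong_int_iff)
    then have "u = v"
      using 0 assms(2) by (simp add: cong_def)
    moreover have "u \<in> verts (with_proj (MC 2 h))"
      using 0 by (simp add: MC_def)
    ultimately show ?case
      by (intro exI[of _ "[]"]) (simp add: awalk_Nil_iff)
  next
    case (Suc n)
    then have "wt h (int u - int v) > 0" by simp
    then obtain i d where i: "i < h" and d: "d = 2 ^ i \<or> d = - (2 ^ i)"
      and less: "Suc (wt h (int u - int v + d)) = wt h (int u - int v)"
      using wt_decreasing_step by blast
    \<comment> \<open>Vertices are least residues, so the endpoint \<open>u + d\<close> of the step
      has to be reduced.\<close>
    define y where "y = nat ((int u + d) mod 2 ^ h)"
    have int_y: "int y = (int u + d) mod 2 ^ h" by (simp add: y_def)
    then have y_less: "y < 2 ^ h"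
      by (simp add: y_def nat_less_iff)
    have cong_y: "[int y = int u + d] (mod 2 ^ h)"
      by (simp add: int_y cong_def)
    have "[int y - int v = int u + d - int v] (mod 2 ^ h)"
      using cong_y by (intro cong_diff) auto
    then have "wt h (int y - int v) = wt h (int u - int v + d)"
      by (intro wt_cong) (simp add: algebra_simps)
    then have wt_y: "Suc (wt h (int y - int v)) = wt h (int u - int v)"
      using less by simp
    then obtain p where p: "awalk y p v" "length p = wt h (int y - int v)"
      using Suc.hyps y_less by force
    have "[int u - int y = int u - (int u + d)] (mod 2 ^ h)"
      using cong_y by (intro cong_diff) auto
    then have "[int u - int y = - d] (mod 2 ^ h)" by simp
    then have "[int u - int y = 2 ^ i] (mod 2 ^ h) \<or> [int u - int y = - (2 ^ i)] (mod 2 ^ h)"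
      using d by auto
    \<comment> \<open>The graph has no loops; the strict drop of \<open>wt\<close> separates the two
      vertices.\<close>
    moreover have "u \<noteq> y" using wt_y by auto
    ultimately have "(u, y) \<in> parcs (MC 2 h)"
      using i Suc.prems y_less by (auto simp: MC_def)
    then have "awalk u ((u, y) # p) v"
      using p by (simp add: awalk_Cons_iff)
    then show ?case
      using p wt_y by (intro exI[of _ "(u, y) # p"]) simp
  qed
qed

text \<open>\<open>\<mu>\<close> is an infimum over all walks; a shortest walk attains it and makes
  it finite.\<close>

lemma graph_dist_eqI:
  assumes wf: "wf_digraph (with_proj G)"
    and walk: "pre_digraph.awalk (with_proj G) u p v"
    and least: "\<And>q. pre_digraph.awalk (with_proj G) u q v \<Longrightarrow> length p \<le> length q"
  shows "graph_dist G u v = real (length p)"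
proof -
  interpret wf_digraph "with_proj G" by (rule wf)
  have cost: "awalk_cost (\<lambda>_. 1) q = real (length q)" for q :: "('a \<times> 'a) list"
    by (induction q) simp_all
  have "\<mu> (\<lambda>_. 1) u v = ereal (real (length p))"
    unfolding \<mu>_def cost
  proof (rule antisym)
    show "(INF q\<in>{q. awalk u q v}. ereal (real (length q))) \<le> ereal (real (length p))"
      using walk by (auto intro: INF_lower2)
    show "ereal (real (length p)) \<le> (INF q\<in>{q. awalk u q v}. ereal (real (length q)))"
      using least by (auto intro!: INF_greatest)
  qed
  then show ?thesis by (simp add: graph_dist_def)
qed

lemma graph_dist_MC_2:
  assumes "u < 2 ^ h" "v < 2 ^ h"
  shows "graph_dist (MC 2 h) u v = real (wt h (int u - int v))"
proof -
  from ex_awalk_length_wt[OF assms] obtain p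
    where p: "pre_digraph.awalk (with_proj (MC 2 h)) u p v" "length p = wt h (int u - int v)"
    by blast
  show ?thesis
    using graph_dist_eqI[OF wf_digraph_MC p(1)] wt_le_length_awalk p(2) by metis
qed

section \<open>The spectral radius\<close>

text \<open>The all-ones vector is an eigenvector.\<close>

lemma eigenvalue_constant_row_sum:
  fixes A :: "'a::comm_ring_1 mat"
  assumes A: "A \<in> carrier_mat n n" and "n > 0"
    and row: "\<And>i. i < n \<Longrightarrow> (\<Sum>j<n. A $$ (i, j)) = r"
  shows "eigenvalue A r"
proof -
  let ?v = "vec n (\<lambda>_. 1 :: 'a)"
  have "?v \<noteq> 0\<^sub>v n"
  proof
    assume "?v = 0\<^sub>v n"
    then have "?v $ 0 = 0\<^sub>v n $ 0" by simp
    then show False using \<open>n > 0\<close> by simp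
  qed
  moreover have "A *\<^sub>v ?v = r \<cdot>\<^sub>v ?v"
    using A row by (intro eq_vecI) (auto simp: scalar_prod_def atLeast0LessThan)
  ultimately show ?thesis
    using A by (auto simp: eigenvalue_def eigenvector_def intro!: exI[of _ ?v])
qed

text \<open>
  Compare both sides of \<open>A v = k v\<close> in a coordinate where \<open>|v|\<close> is maximal.
\<close>
lemma eigenvalue_le_row_sum:
  fixes A :: "real mat"
  assumes A: "A \<in> carrier_mat n n"
    and nonneg: "\<And>i j. i < n \<Longrightarrow> j < n \<Longrightarrow> A $$ (i, j) \<ge> 0"
    and row: "\<And>i. i < n \<Longrightarrow> (\<Sum>j<n. A $$ (i, j)) \<le> r"
    and k: "eigenvalue A k"
  shows "\<bar>k\<bar> \<le> r"
proof -
  from k A obtain v where v: "v \<in> carrier_vec n" "v \<noteq> 0\<^sub>v n" "A *\<^sub>v v = k \<cdot>\<^sub>v v"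
    by (auto simp: eigenvalue_def eigenvector_def)
  from v(1,2) obtain l where l: "l < n" "v $ l \<noteq> 0"
    by (auto simp: vec_eq_iff)
  define M where "M = Max ((\<lambda>i. \<bar>v $ i\<bar>) ` {..<n})"
  have M: "\<bar>v $ j\<bar> \<le> M" if "j < n" for j
    unfolding M_def using that by (intro Max_ge) auto
  have "M \<in> (\<lambda>i. \<bar>v $ i\<bar>) ` {..<n}"
    unfolding M_def using l(1) by (intro Max_in) auto
  then obtain i where i: "i < n" "M = \<bar>v $ i\<bar>" by auto
  have "M > 0" using M[OF l(1)] l(2) by linarith
  have "k * v $ i = (A *\<^sub>v v) $ i"
    using v i by simp
  also have "\<dots> = (\<Sum>j<n. A $$ (i, j) * v $ j)"
    using A v(1) i by (auto simp: scalar_prod_def atLeast0LessThan)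
  finally have "\<bar>k\<bar> * M = \<bar>\<Sum>j<n. A $$ (i, j) * v $ j\<bar>"
    by (simp add: i(2) flip: abs_mult)
  also have "\<dots> \<le> (\<Sum>j<n. \<bar>A $$ (i, j) * v $ j\<bar>)"
    by (rule sum_abs)
  also have "\<dots> \<le> (\<Sum>j<n. A $$ (i, j) * M)"
    using nonneg i(1) M by (intro sum_mono) (auto simp: abs_mult intro!: mult_left_mono)
  also have "\<dots> = (\<Sum>j<n. A $$ (i, j)) * M"
    by (simp add: sum_distrib_right)
  also have "\<dots> \<le> r * M"
    using row[OF i(1)] \<open>M > 0\<close> by (intro mult_right_mono) auto
  finally show ?thesis using \<open>M > 0\<close> by simp
qed

lemma Max_spectrum_constant_row_sum:
  fixes A :: "real mat"
  assumes A: "A \<in> carrier_mat n n" and "n > 0"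
    and nonneg: "\<And>i j. i < n \<Longrightarrow> j < n \<Longrightarrow> A $$ (i, j) \<ge> 0"
    and row: "\<And>i. i < n \<Longrightarrow> (\<Sum>j<n. A $$ (i, j)) = r"
  shows "Max (spectrum A) = r"
proof (rule Max_eqI)
  show "finite (spectrum A)"
    using A by (rule card_finite_spectrum)
  show "r \<in> spectrum A"
    using eigenvalue_constant_row_sum[OF A \<open>n > 0\<close> row] by (simp add: spectrum_def)
  fix k assume "k \<in> spectrum A"
  then have "\<bar>k\<bar> \<le> r"
    using eigenvalue_le_row_sum[OF A nonneg] row by (simp add: spectrum_def)
  then show "k \<le> r" by simp
qed

lemma distance_matrix_MC_2:
  "distance_matrix (MC 2 h) = mat (2 ^ h) (2 ^ h) (\<lambda>(i, j). real (wt h (int i - int j)))"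
proof -
  \<comment> \<open>The vertex at index \<open>i\<close> is \<open>i\<close> itself, so matrix
    indices are residues.\<close>
  have "sorted_list_of_set (pverts (MC 2 h)) = [0..<2 ^ h]"
    by (simp add: MC_def)
  then show ?thesis
    by (auto simp: distance_matrix_def Let_def graph_dist_MC_2 intro!: eq_matI)
qed

theorem theorem3p20:
  fixes h :: nat
  assumes "h > 0"
  shows "distance_spectral_radius (MC 2 h) = (2 ^ h * (3 * real h + 1) - (-1) ^ h) / 9"
proof -
  \<comment> \<open>Row \<open>i\<close> lists one period of \<open>wt h\<close> backwards from
    \<open>i\<close>, so its sum does not depend on \<open>i\<close>.\<close>
  have "(\<Sum>j<2 ^ h. wt h (int i - int j)) = wt_sum h" for i
    unfolding wt_sum_def by (rule sum_periodic_reflect) 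
      (simp_all only: wt_mod zero_less_power zero_less_numeral)
  then have "(\<Sum>j<2 ^ h. real (wt h (int i - int j))) = real (wt_sum h)" for i
    by (simp flip: of_nat_sum)
  then have "Max (spectrum (distance_matrix (MC 2 h))) = real (wt_sum h)"
    by (intro Max_spectrum_constant_row_sum[of _ "2 ^ h"]) (simp_all add: distance_matrix_MC_2)
  then show ?thesis
    by (simp add: distance_spectral_radius_def wt_sum_closed_form)
qed

end
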